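(* Let $(X,\rho)$ be a partial metric space, let $\lambda=(\lambda_n)$ and $\mu=(\mu_n)$ belong to $\Lambda$ with $\lambda_n\le\mu_n$ for all but finitely many $n\in\mathbb{N}$, and let $0<\alpha\le\beta\le 1$. Then: (i) If $\liminf_{n\to\infty}\frac{\lambda_n^\alpha}{\mu_n^\beta}>0$, then $[V_\rho^\beta,\mu]\subseteq[V_\rho^\alpha,\lambda]$. (ii) If $\lim_{n\to\infty}\frac{\lambda_n^\alpha}{\mu_n^\beta}=1$ and $\lim_{n\to\infty}\frac{\mu_n}{\mu_n^\beta}=1$, then $[V_\rho^\beta,\mu]=[V_\rho^\alpha,\lambda]$.
   Context: A partial metric on a non-empty set $X$ is a function $\rho:X\times X\to\mathbb{R}$ such that for all $x,y,z\in X$: (i) $0\le\rho(x,x)\le\rho(x,y)$; (ii) if $\rho(x,x)=\rho(x,y)=\rho(y,y)$ then $x=y$; (iii) $\rho(x,y)=\rho(y,x)$; (iv) $\rho(x,z)\le\rho(x,y)+\rho(y,z)-\rho(y,y)$. The pair $(X,\rho)$ is called a partial metric space. Sequences are indexed by $\mathbb{N}=\{1,2,3,\dots\}$. $\Lambda$ is the class of all non-decreasing sequences $\lambda=(\lambda_n)$ of positive real numbers tending to $\infty$ with $\lambda_1=1$ and $\lambda_{n+1}\le\lambda_n+1$ for all $n$. For $\lambda\in\Lambda$ and $\alpha\in(0,1]$, a sequence $(x_k)$ in $X$ is strongly $[V_\rho^\alpha,\lambda]$-summable of order $\alpha$ to $x\in X$ if $\lim_{n\to\infty}\frac{1}{\lambda_n^\alpha}\sum_{k\in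 I_n}|\rho(x_k,x)-\rho(x,x)|=0$, where the sum is over integers $k\in I_n=[n-\lambda_n+1,n]$. $[V_\rho^\alpha,\lambda]$ denotes the set of all sequences in $X$ that are strongly $[V_\rho^\alpha,\lambda]$-summable of order $\alpha$ to some $x\in X$; $[V_\rho^\beta,\mu]$ is defined in the same way with $\mu,\beta$ in place of $\lambda,\alpha$ (the interval being $[n-\mu_n+1,n]$). *)

theory Defs
  imports Complex_Main "HOL-Library.FuncSet" "HOL-Library.Extended_Real"
begin

locale partial_metric_space =
  fixes X :: "'a set" and \<rho> :: "'a \<Rightarrow> 'a \<Rightarrow> real"
  assumes nonempty: "X \<noteq> {}"
    and self_nonneg: "x \<in> X \<Longrightarrow> 0 \<le> \<rho> x x"
    and self_le: "x \<in> X \<Longrightarrow> y \<in> X \<Longrightarrow> \<rho> x x \<le> \<rho> x y"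
    and eq_if_self_eq:
      "x \<in> X \<Longrightarrow> y \<in> X \<Longrightarrow> \<rho> x x = \<rho> x y \<Longrightarrow> \<rho> x y = \<rho> y y \<Longrightarrow> x = y"
    and commute: "x \<in> X \<Longrightarrow> y \<in> X \<Longrightarrow> \<rho> x y = \<rho> y x"
    and triangle:
      "x \<in> X \<Longrightarrow> y \<in> X \<Longrightarrow> z \<in> X \<Longrightarrow> \<rho> x z \<le> \<rho> x y + \<rho> y z - \<rho> y y"

text \<open>Sequences are indexed by the positive integers: real sequences are functions on \<open>nat\<close> whose
  value at 0 is irrelevant, and sequences in \<open>X\<close> are the extensional functions on \<open>{1..}\<close>, so that
  each sequence is represented by exactly one function.\<close>

definition Lambda_class :: "(nat \<Rightarrow> real) set" where
  "Lambda_class = {l. (\<forall>n\<ge>1. 0 < l n) \<and> mono_on {1..} l \<and> filterlim l at_top sequentially \<and>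
     l 1 = 1 \<and> (\<forall>n\<ge>1. l (n + 1) \<le> l n + 1)}"

definition window :: "(nat \<Rightarrow> real) \<Rightarrow> nat \<Rightarrow> nat set" where
  "window l n = {k. real k \<in> {real n - l n + 1..real n}}"

text \<open>Ranging over natural numbers loses no integer of the interval, and the index 0 never
  occurs:\<close>

lemma Lambda_class_le:
  assumes "l \<in> Lambda_class" "n \<ge> 1"
  shows "l n \<le> real n"
  using assms(2)
proof (induction n rule: dec_induct)
  case base
  then show ?case using assms(1) by (simp add: Lambda_class_def)
next
  case (step n)
  then have "l (n + 1) \<le> l n + 1"
    using assms(1) by (simp add: Lambda_class_def)
  with step show ?case by simp
qed

lemma int_window_eq:
  assumes "l \<in> Lambda_class" "n \<ge> 1"
  shows "int ` window l n = {k. of_int k \<in> {real n - l n + 1..real n}}"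
    and "window l n \<subseteq> {1..n}"
proof -
  have le: "1 \<le> real n - l n + 1"
    using Lambda_class_le[OF assms] by simp
  show "window l n \<subseteq> {1..n}"
    using le by (force simp: window_def)
  show "int ` window l n = {k. of_int k \<in> {real n - l n + 1..real n}}"
  proof (intro equalityI subsetI)
    fix k assume k: "k \<in> {k. of_int k \<in> {real n - l n + 1..real n}}"
    then have "1 \<le> real_of_int k" using le by simp
    then have "k = int (nat k)" by simp
    with k show "k \<in> int ` window l n"
      by (metis (mono_tags) imageI mem_Collect_eq of_int_of_nat_eq window_def)
  qed (auto simp: window_def)
qed

definition strongly_summable_to ::
    "('a \<Rightarrow> 'a \<Rightarrow> real) \<Rightarrow> real \<Rightarrow> (nat \<Rightarrow> real) \<Rightarrow> (nat \<Rightarrow> 'a) \<Rightarrow> 'a \<Rightarrow> bool" where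
  "strongly_summable_to \<rho> \<alpha> l x a \<longleftrightarrow>
     (\<lambda>n. 1 / (l n powr \<alpha>) * (\<Sum>k\<in>window l n. \<bar>\<rho> (x k) a - \<rho> a a\<bar>)) \<longlonglongrightarrow> 0"

definition strongly_summable_seqs ::
    "'a set \<Rightarrow> ('a \<Rightarrow> 'a \<Rightarrow> real) \<Rightarrow> real \<Rightarrow> (nat \<Rightarrow> real) \<Rightarrow> (nat \<Rightarrow> 'a) set" where
  "strongly_summable_seqs X \<rho> \<alpha> l =
     {x \<in> {1..} \<rightarrow>\<^sub>E X. \<exists>a\<in>X. strongly_summable_to \<rho> \<alpha> l x a}"

end

theory Submission
  imports Defs
begin

text \<open>
  Write \<open>d k = \<bar>\<rho> (x k) a - \<rho> a a\<bar>\<close>; every inclusion is proved with the same limit point \<open>a\<close>, by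
  comparing window sums of the nonnegative sequence \<open>d\<close>.

  If \<open>l n \<le> \<mu> n\<close>, then the window of \<open>l\<close> at \<open>n\<close> lies in that of \<open>\<mu>\<close>, so its sum is smaller, and a
  positive lower bound \<open>c\<close> of \<open>l n powr \<alpha> / \<mu> n powr \<beta>\<close> changes the normalisation by a factor of at
  most \<open>1 / c\<close>. This gives the inclusion under the liminf condition, which also holds when the
  ratio tends to 1.

  For the converse inclusion, the two limits leave only the case \<open>\<alpha> = \<beta> = 1\<close>, because a nonzero
  power of a sequence tending to infinity cannot tend to 1 (lemma \<open>orders_eq_one\<close>). In this
  case summability carries over from the shorter windows of \<open>l\<close> to the longer ones of \<open>\<mu>\<close>: a long
  interval ending at \<open>n\<close> is covered, from right to left, by consecutive disjoint windows of \<open>l\<close>. On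
  each of them, apart from finitely many indices, the sum is at most \<open>2 * \<epsilon>\<close> times the number of
  elements, and together they overshoot the interval by at most \<open>l n\<close> elements (lemma \<open>interval_sum_le\<close>). The
  sequence \<open>d\<close> may be unbounded, so the indices in the longer window but outside the shorter one
  cannot be neglected merely because there are few of them.
\<close>

section \<open>Windows\<close>

lemma Lambda_class_mono:
  "l \<in> Lambda_class \<Longrightarrow> 1 \<le> m \<Longrightarrow> m \<le> n \<Longrightarrow> l m \<le> l n"
  by (auto simp: Lambda_class_def mono_on_def)

lemma Lambda_class_ge_1:
  "l \<in> Lambda_class \<Longrightarrow> 1 \<le> n \<Longrightarrow> 1 \<le> l n"
  using Lambda_class_mono[of l 1 n] by (simp add: Lambda_class_def)

lemma Lambda_class_at_top:
  "l \<in> Lambda_class \<Longrightarrow> filterlim l at_top sequentially"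
  by (simp add: Lambda_class_def)

lemma finite_window: "finite (window l n)"
  by (rule finite_subset[of _ "{..n}"]) (auto simp: window_def)

lemma window_mono: "l n \<le> \<mu> n \<Longrightarrow> window l n \<subseteq> window \<mu> n"
  by (auto simp: window_def)

section \<open>Passing to shorter windows\<close>

text \<open>This is about weighted window sums of any nonnegative sequence \<open>d\<close>; the weights \<open>u\<close> and \<open>v\<close>
  stand for the powers of \<open>l\<close> and \<open>\<mu>\<close>.\<close>

lemma window_means_shorter:
  fixes d u v :: "nat \<Rightarrow> real"
  assumes nonneg: "\<And>k. 0 \<le> d k"
    and le: "\<forall>\<^sub>F n in sequentially. l n \<le> \<mu> n"
    and pos: "\<forall>\<^sub>F n in sequentially. 0 < u n \<and> 0 < v n"
    and liminf: "liminf (\<lambda>n. ereal (u n / v n)) > 0"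
    and lim: "(\<lambda>n. 1 / v n * sum d (window \<mu> n)) \<longlonglongrightarrow> 0"
  shows "(\<lambda>n. 1 / u n * sum d (window l n)) \<longlonglongrightarrow> 0"
proof -
  obtain c where c: "0 < ereal c" "ereal c < liminf (\<lambda>n. ereal (u n / v n))"
    using ereal_dense2[OF liminf] by auto
  have ev: "\<forall>\<^sub>F n in sequentially. c < u n / v n"
    using less_LiminfD[OF c(2)] by simp
  show ?thesis
  proof (rule tendsto_sandwich)
    show "(\<lambda>_. 0 :: real) \<longlonglongrightarrow> 0" by simp
    show "(\<lambda>n. (1 / c) * (1 / v n * sum d (window \<mu> n))) \<longlonglongrightarrow> 0"
      using tendsto_mult_left[OF lim, of "1 / c"] by simp
    show "\<forall>\<^sub>F n in sequentially. 0 \<le> 1 / u n * sum d (window l n)"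
      using pos by eventually_elim (simp add: sum_nonneg nonneg)
    show "\<forall>\<^sub>F n in sequentially.
        1 / u n * sum d (window l n) \<le> (1 / c) * (1 / v n * sum d (window \<mu> n))"
      using pos le ev
    proof eventually_elim
      case (elim n)
      have "c * v n < u n"
        using elim by (simp add: field_simps)
      then have "1 / u n \<le> 1 / (c * v n)"
        using c(1) elim by (intro divide_left_mono) auto
      moreover have "sum d (window l n) \<le> sum d (window \<mu> n)"
        using elim by (intro sum_mono2 finite_window window_mono nonneg)
      ultimately have "1 / u n * sum d (window l n) \<le> 1 / (c * v n) * sum d (window \<mu> n)"
        using c(1) elim by (intro mult_mono) (auto intro: sum_nonneg nonneg)
      then show ?case by simp
    qed
  qed
qed

section \<open>Passing to longer windows when both orders are 1\<close>

text \<open>The interval \<open>{j..n}\<close> is covered greedily from the right by windows of \<open>l\<close>. The window at \<open>n\<close>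
  contains \<open>\<lfloor>l n\<rfloor> \<ge> l n / 2\<close> integers, so its sum, at most \<open>\<epsilon> * l n\<close>, is paid for by its number
  of elements at the price of \<open>2 * \<epsilon>\<close> each. The summand \<open>l n\<close> on the right pays for the last
  window, which may reach below \<open>j\<close>, and \<open>C\<close> for the windows at indices below \<open>N\<close>, which
  need not satisfy the bound.\<close>

lemma interval_sum_le:
  fixes d :: "nat \<Rightarrow> real"
  assumes l: "l \<in> Lambda_class"
    and nonneg: "\<And>k. 0 \<le> d k" and "0 \<le> \<epsilon>"
    and window: "\<And>n. N \<le> n \<Longrightarrow> sum d (window l n) \<le> \<epsilon> * l n"
    and C: "C = sum d {..N}"
    and "1 \<le> j" "j \<le> n"
  shows "sum d {j..n} \<le> C + 2 * \<epsilon> * (real n - real j + 1 + l n)"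
  using \<open>j \<le> n\<close>
proof (induction n rule: less_induct)
  case (less n)
  have n: "1 \<le> n" using less.prems \<open>1 \<le> j\<close> by simp
  note ge1 = Lambda_class_ge_1[OF l n] and le_n = Lambda_class_le[OF l n]
  have "0 \<le> C" by (simp add: C sum_nonneg nonneg)
  show ?case
  proof (cases "N \<le> n")
    case False
    then have "sum d {j..n} \<le> C"
      unfolding C by (intro sum_mono2) (auto intro: nonneg)
    moreover have "0 \<le> 2 * \<epsilon> * (real n - real j + 1 + l n)"
      using \<open>0 \<le> \<epsilon>\<close> less.prems ge1 by (intro mult_nonneg_nonneg) auto
    ultimately show ?thesis by simp
  next
    case True
    define q where "q = nat \<lfloor>l n\<rfloor>"
    have q: "1 \<le> q" "real q \<le> l n" "l n < real q + 1"
      using ge1 by (auto simp: q_def le_nat_iff le_floor_iff)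
    have "q \<le> n" using q(2) le_n by linarith
    have half: "l n \<le> 2 * real q" using q by linarith
    define p where "p = n - q"
    have p: "real p = real n - real q" using \<open>q \<le> n\<close> by (simp add: p_def)
    have "{p<..n} \<subseteq> window l n"
    proof
      fix k assume "k \<in> {p<..n}"
      then have "real p + 1 \<le> real k" "k \<le> n" by auto
      then show "k \<in> window l n" using p q by (auto simp: window_def)
    qed
    then have "sum d {p<..n} \<le> sum d (window l n)"
      by (intro sum_mono2 finite_window nonneg)
    then have last: "sum d {p<..n} \<le> \<epsilon> * l n"
      using window[OF True] by linarith
    show ?thesis
    proof (cases "j \<le> p")
      case True
      have "p < n" using q \<open>q \<le> n\<close> by (simp add: p_def)
      then have "{j..n} = {j..p} \<union> {p<..n}" "{j..p} \<inter> {p<..n} = {}"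
        using True by auto
      then have "sum d {j..n} = sum d {j..p} + sum d {p<..n}"
        by (simp add: sum.union_disjoint)
      also have "\<dots> \<le> C + 2 * \<epsilon> * (real p - real j + 1 + l p) + \<epsilon> * l n"
        using less.IH[OF \<open>p < n\<close> True] last by simp
      also have "\<dots> \<le> C + 2 * \<epsilon> * (real p - real j + 1 + l n) + \<epsilon> * (2 * real q)"
        using Lambda_class_mono[OF l, of p n] \<open>p < n\<close> True \<open>1 \<le> j\<close> \<open>0 \<le> \<epsilon>\<close> half
        by (intro add_mono mult_left_mono) auto
      also have "\<dots> = C + 2 * \<epsilon> * (real n - real j + 1 + l n)"
        by (simp add: p algebra_simps)
      finally show ?thesis .
    next
      case False
      then have "sum d {j..n} \<le> sum d {p<..n}"
        by (intro sum_mono2) (auto intro: nonneg)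
      also have "\<dots> \<le> \<epsilon> * l n" by (rule last)
      also have "\<dots> \<le> \<epsilon> * (2 * (real n - real j + 1 + l n))"
        using less.prems ge1 \<open>0 \<le> \<epsilon>\<close> by (intro mult_left_mono) auto
      finally show ?thesis using \<open>0 \<le> C\<close> by (simp add: mult.assoc mult.left_commute)
    qed
  qed
qed

lemma window_means_longer:
  fixes d :: "nat \<Rightarrow> real"
  assumes l: "l \<in> Lambda_class" and \<mu>: "\<mu> \<in> Lambda_class"
    and nonneg: "\<And>k. 0 \<le> d k"
    and le: "\<forall>\<^sub>F n in sequentially. l n \<le> \<mu> n"
    and lim: "(\<lambda>n. 1 / l n * sum d (window l n)) \<longlonglongrightarrow> 0"
  shows "(\<lambda>n. 1 / \<mu> n * sum d (window \<mu> n)) \<longlonglongrightarrow> 0"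
proof (rule order_tendstoI)
  fix e :: real assume "e < 0"
  show "\<forall>\<^sub>F n in sequentially. e < 1 / \<mu> n * sum d (window \<mu> n)"
    using eventually_ge_at_top[of 1]
  proof eventually_elim
    case (elim n)
    have "0 \<le> 1 / \<mu> n * sum d (window \<mu> n)"
      using Lambda_class_ge_1[OF \<mu> elim] by (simp add: sum_nonneg nonneg)
    with \<open>e < 0\<close> show ?case by simp
  qed
next
  fix e :: real assume "0 < e"
  \<comment> \<open>The window at \<open>n\<close> will be bounded by \<open>C + 4 * \<epsilon> * \<mu> n\<close>, so \<open>\<epsilon> = e / 8\<close> leaves \<open>e / 2 * \<mu> n\<close> for \<open>C\<close>.\<close>
  define \<epsilon> where "\<epsilon> = e / 8"
  have "0 < \<epsilon>" using \<open>0 < e\<close> by (simp add: \<epsilon>_def)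
  have "\<forall>\<^sub>F n in sequentially. 1 / l n * sum d (window l n) < \<epsilon>"
    by (rule order_tendstoD(2)[OF lim \<open>0 < \<epsilon>\<close>])
  then have "\<forall>\<^sub>F n in sequentially. sum d (window l n) \<le> \<epsilon> * l n"
    using eventually_ge_at_top[of 1]
  proof eventually_elim
    case (elim n)
    then show ?case using Lambda_class_ge_1[OF l, of n] by (simp add: field_simps)
  qed
  then obtain N where N: "\<And>n. N \<le> n \<Longrightarrow> sum d (window l n) \<le> \<epsilon> * l n"
    by (auto simp: eventually_sequentially)
  define C where "C = sum d {..N}"
  have "\<forall>\<^sub>F n in sequentially. 2 * C / e < \<mu> n"
    using Lambda_class_at_top[OF \<mu>] by (simp add: filterlim_at_top_dense)
  then show "\<forall>\<^sub>F n in sequentially. 1 / \<mu> n * sum d (window \<mu> n) < e"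
    using le eventually_ge_at_top[of 1]
  proof eventually_elim
    case (elim n)
    have ge1: "1 \<le> \<mu> n" by (rule Lambda_class_ge_1[OF \<mu> elim(3)])
    have le_n: "\<mu> n \<le> real n" by (rule Lambda_class_le[OF \<mu> elim(3)])
    define j where "j = nat \<lceil>real n - \<mu> n + 1\<rceil>"
    have j_ge: "real n - \<mu> n + 1 \<le> real j"
      unfolding j_def by linarith
    then have "1 \<le> j" using le_n by linarith
    have "j \<le> n" using ge1 unfolding j_def by linarith
    have "window \<mu> n \<subseteq> {j..n}"
      unfolding window_def j_def by (auto simp: nat_le_iff) linarith
    then have "sum d (window \<mu> n) \<le> sum d {j..n}"
      by (intro sum_mono2) (auto intro: nonneg)
    also have "\<dots> \<le> C + 2 * \<epsilon> * (real n - real j + 1 + l n)"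
      using interval_sum_le[OF l nonneg _ N C_def \<open>1 \<le> j\<close> \<open>j \<le> n\<close>] \<open>0 < \<epsilon>\<close> by simp
    also have "\<dots> \<le> C + 2 * \<epsilon> * (\<mu> n + \<mu> n)"
      using j_ge elim(2) \<open>0 < \<epsilon>\<close> by (intro add_mono mult_left_mono) auto
    also have "\<dots> < e * \<mu> n"
      using elim(1) \<open>0 < e\<close> by (simp add: \<epsilon>_def field_simps)
    finally show ?case using ge1 by (simp add: field_simps)
  qed
qed

section \<open>The limits force both orders to be 1\<close>

lemma powr_tendsto_1_imp_exponent_0:
  fixes f :: "nat \<Rightarrow> real"
  assumes "filterlim f at_top sequentially" "(\<lambda>n. f n powr s) \<longlonglongrightarrow> 1" "s \<le> 0"
  shows "s = 0"
proof (rule ccontr)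
  assume "s \<noteq> 0"
  with assms have "(\<lambda>n. f n powr s) \<longlonglongrightarrow> 0"
    by (intro tendsto_neg_powr) auto
  with assms(2) show False using LIMSEQ_unique by fastforce
qed

text \<open>The second limit is that of \<open>\<mu> n powr (1 - \<beta>)\<close> and forces \<open>\<beta> = 1\<close>. Then the first ratio is at
  most \<open>l n powr (\<alpha> - 1)\<close>, which is at most 1 and hence also tends to 1.\<close>

lemma orders_eq_one:
  assumes l: "l \<in> Lambda_class" and \<mu>: "\<mu> \<in> Lambda_class"
    and le: "\<forall>\<^sub>F n in sequentially. l n \<le> \<mu> n"
    and "\<alpha> \<le> 1" "\<beta> \<le> 1"
    and lim1: "(\<lambda>n. l n powr \<alpha> / \<mu> n powr \<beta>) \<longlonglongrightarrow> 1"
    and lim2: "(\<lambda>n. \<mu> n / \<mu> n powr \<beta>) \<longlonglongrightarrow> 1"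
  shows "\<alpha> = 1" "\<beta> = 1"
proof -
  have "\<forall>\<^sub>F n in sequentially. inverse (\<mu> n / \<mu> n powr \<beta>) = \<mu> n powr (\<beta> - 1)"
    using eventually_ge_at_top[of 1]
  proof eventually_elim
    case (elim n)
    then show ?case using Lambda_class_ge_1[OF \<mu>, of n] by (simp add: powr_diff)
  qed
  moreover have "(\<lambda>n. inverse (\<mu> n / \<mu> n powr \<beta>)) \<longlonglongrightarrow> 1"
    using tendsto_inverse[OF lim2] by simp
  ultimately have "(\<lambda>n. \<mu> n powr (\<beta> - 1)) \<longlonglongrightarrow> 1"
    by (rule Lim_transform_eventually[rotated])
  from powr_tendsto_1_imp_exponent_0[OF Lambda_class_at_top[OF \<mu>] this]
  show "\<beta> = 1" using \<open>\<beta> \<le> 1\<close> by simp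
  have "(\<lambda>n. l n powr (\<alpha> - 1)) \<longlonglongrightarrow> 1"
  proof (rule tendsto_sandwich[OF _ _ lim1 tendsto_const])
    show "\<forall>\<^sub>F n in sequentially. l n powr \<alpha> / \<mu> n powr \<beta> \<le> l n powr (\<alpha> - 1)"
      using le eventually_ge_at_top[of 1]
    proof eventually_elim
      case (elim n)
      have "1 \<le> l n" by (rule Lambda_class_ge_1[OF l elim(2)])
      then have "l n powr \<alpha> / \<mu> n \<le> l n powr \<alpha> / l n"
        using elim(1) by (intro divide_left_mono) simp_all
      then show ?case
        using elim(1) \<open>1 \<le> l n\<close> unfolding \<open>\<beta> = 1\<close> by (simp add: powr_diff)
    qed
    show "\<forall>\<^sub>F n in sequentially. l n powr (\<alpha> - 1) \<le> 1"
      using eventually_ge_at_top[of 1]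
    proof eventually_elim
      case (elim n)
      have "1 \<le> l n" by (rule Lambda_class_ge_1[OF l elim])
      then have "l n powr (\<alpha> - 1) \<le> l n powr 0"
        using \<open>\<alpha> \<le> 1\<close> by (intro powr_mono) auto
      then show ?case using \<open>1 \<le> l n\<close> by simp
    qed
  qed
  from powr_tendsto_1_imp_exponent_0[OF Lambda_class_at_top[OF l] this]
  show "\<alpha> = 1" using \<open>\<alpha> \<le> 1\<close> by simp
qed

section \<open>Comparison of the summability classes\<close>

lemma strongly_summable_seqs_subset:
  assumes l: "l \<in> Lambda_class" and \<mu>: "\<mu> \<in> Lambda_class"
    and le: "\<forall>\<^sub>F n in sequentially. l n \<le> \<mu> n"
    and liminf: "liminf (\<lambda>n. ereal (l n powr \<alpha> / \<mu> n powr \<beta>)) > 0"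
  shows "strongly_summable_seqs X \<rho> \<beta> \<mu> \<subseteq> strongly_summable_seqs X \<rho> \<alpha> l"
proof -
  have pos: "\<forall>\<^sub>F n in sequentially. 0 < l n powr \<alpha> \<and> 0 < \<mu> n powr \<beta>"
    using eventually_ge_at_top[of 1]
  proof eventually_elim
    case (elim n)
    then show ?case using Lambda_class_ge_1[OF l elim] Lambda_class_ge_1[OF \<mu> elim] by simp
  qed
  have "strongly_summable_to \<rho> \<alpha> l x a" if "strongly_summable_to \<rho> \<beta> \<mu> x a" for x a
    using that unfolding strongly_summable_to_def
    by (rule window_means_shorter[OF _ le pos liminf, rotated]) simp
  then show ?thesis by (auto simp: strongly_summable_seqs_def)
qed

lemma strongly_summable_seqs_order_one_subset:
  assumes l: "l \<in> Lambda_class" and \<mu>: "\<mu> \<in> Lambda_class"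
    and le: "\<forall>\<^sub>F n in sequentially. l n \<le> \<mu> n"
  shows "strongly_summable_seqs X \<rho> 1 l \<subseteq> strongly_summable_seqs X \<rho> 1 \<mu>"
proof -
  have iff: "strongly_summable_to \<rho> 1 w x a \<longleftrightarrow>
      (\<lambda>n. 1 / w n * (\<Sum>k\<in>window w n. \<bar>\<rho> (x k) a - \<rho> a a\<bar>)) \<longlonglongrightarrow> 0"
    if w: "w \<in> Lambda_class" for w x a
    unfolding strongly_summable_to_def
  proof (rule tendsto_cong)
    show "\<forall>\<^sub>F n in sequentially. 1 / (w n powr 1) * (\<Sum>k\<in>window w n. \<bar>\<rho> (x k) a - \<rho> a a\<bar>) =
        1 / w n * (\<Sum>k\<in>window w n. \<bar>\<rho> (x k) a - \<rho> a a\<bar>)"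
      using eventually_ge_at_top[of 1]
    proof eventually_elim
      case (elim n)
      then show ?case using Lambda_class_ge_1[OF w, of n] by simp
    qed
  qed
  have "strongly_summable_to \<rho> 1 \<mu> x a" if "strongly_summable_to \<rho> 1 l x a" for x a
    using that unfolding iff[OF l] iff[OF \<mu>]
    by (rule window_means_longer[OF l \<mu> _ le, rotated]) simp
  then show ?thesis by (auto simp: strongly_summable_seqs_def)
qed

theorem theorem3p10:
  fixes X :: "'a set" and \<rho> :: "'a \<Rightarrow> 'a \<Rightarrow> real"
    and l \<mu> :: "nat \<Rightarrow> real" and \<alpha> \<beta> :: real
  assumes "partial_metric_space X \<rho>"
    and "l \<in> Lambda_class" and "\<mu> \<in> Lambda_class"
    and "\<forall>\<^sub>F n in sequentially. l n \<le> \<mu> n"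
    and "0 < \<alpha>" and "\<alpha> \<le> \<beta>" and "\<beta> \<le> 1"
  shows "(liminf (\<lambda>n. ereal (l n powr \<alpha> / \<mu> n powr \<beta>)) > 0 \<longrightarrow>
            strongly_summable_seqs X \<rho> \<beta> \<mu> \<subseteq> strongly_summable_seqs X \<rho> \<alpha> l)
       \<and> ((\<lambda>n. l n powr \<alpha> / \<mu> n powr \<beta>) \<longlonglongrightarrow> 1 \<and> (\<lambda>n. \<mu> n / \<mu> n powr \<beta>) \<longlonglongrightarrow> 1 \<longrightarrow>
            strongly_summable_seqs X \<rho> \<beta> \<mu> = strongly_summable_seqs X \<rho> \<alpha> l)"
proof (intro conjI impI)
  note shorter = strongly_summable_seqs_subset[OF assms(2-4)]
  show "strongly_summable_seqs X \<rho> \<beta> \<mu> \<subseteq> strongly_summable_seqs X \<rho> \<alpha> l"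
    if "liminf (\<lambda>n. ereal (l n powr \<alpha> / \<mu> n powr \<beta>)) > 0"
    by (rule shorter[OF that])
  assume lims: "(\<lambda>n. l n powr \<alpha> / \<mu> n powr \<beta>) \<longlonglongrightarrow> 1 \<and> (\<lambda>n. \<mu> n / \<mu> n powr \<beta>) \<longlonglongrightarrow> 1"
  then have "(\<lambda>n. ereal (l n powr \<alpha> / \<mu> n powr \<beta>)) \<longlonglongrightarrow> ereal 1"
    by simp
  then have "liminf (\<lambda>n. ereal (l n powr \<alpha> / \<mu> n powr \<beta>)) = ereal 1"
    by (intro lim_imp_Liminf) auto
  then have "liminf (\<lambda>n. ereal (l n powr \<alpha> / \<mu> n powr \<beta>)) > 0"
    by simp
  moreover have "\<alpha> = 1" "\<beta> = 1"
    using orders_eq_one[OF assms(2-4) order_trans[OF assms(6,7)] assms(7)] lims by blast+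
  ultimately show "strongly_summable_seqs X \<rho> \<beta> \<mu> = strongly_summable_seqs X \<rho> \<alpha> l"
    using shorter strongly_summable_seqs_order_one_subset[OF assms(2-4)] by blast
qed

end
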